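(* Let $m\ge 2$, let $\Gamma$ be a compact Lie group, let $\sigma:\Gamma\to\mathbf{Z}_m$ be a group epimorphism with kernel $K=\ker\sigma$, let $\delta\in\Gamma$ be such that $\sigma(\delta)$ is a primitive $m$-th root of unity, and let $\rho,\eta:\Gamma\to\mathbf{GL}(V)$ be two representations of $\Gamma$ on a finite-dimensional complex vector space $V$. Let $\{u_1,\ldots,u_s\}$ be a Hilbert basis of $\mathcal{P}(K)$. Set $\mathcal{B}_0=\{1\}$ and, for each $l\in\{1,\ldots,m-1\}$, let $\mathcal{B}_l$ be a finite generating set of the $\mathcal{P}(\Gamma)$-module $\mathcal{P}_{\sigma^l}(\Gamma)$ consisting of products $$\prod_{r=1}^{m-1}\prod_{i=1}^{s}R_r(u_i)^{\alpha_{ri}},\qquad \alpha_{ri}\in\mathbf{Z}_{\ge 0},\qquad \sum_{r=1}^{m-1} r\,(\alpha_{r1}+\cdots+\alpha_{rs})\equiv l \pmod m.$$ Let $\mathcal{B}=\bigcup_{l=0}^{m-1}\mathcal{B}_l=\{v_0\equiv 1,v_1,\ldots,v_p\}$, which is a generating set of $\mathcal{P}(K)$ as a module over $\mathcal{P}(\Gamma)$. Let $\{H_0,\ldots,H_q\}$ be a generating set of the module $\vec{\mathcal{P}}(K)$ over the ring $\mathcal{P}(K)$. Then, for each $j\in\{0,\ldots,m-1\}$, $$\{\vec{R}_j(v_iH_k): i=0,\ldots,p;\ k=0,\ldots,q\}$$ is a set of generators for $\vec{\mathcal{P}}_{\sigma^j}(\Gamma)$ as a module over $\mathcal{P}(\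Gamma)$.
   Context: $\mathbf{Z}_m\subset\mathbf{C}^{*}$ is the cyclic group of $m$-th roots of unity, and $\sigma^j(\gamma)=\sigma(\gamma)^j$. Polynomial functions and mappings on $V$ have complex coefficients. $\mathcal{P}(\Gamma)$ (resp. $\mathcal{P}(K)$) is the ring of polynomial functions $f:V\to\mathbf{C}$ with $f(\rho(\gamma)x)=f(x)$ for all $x\in V$ and all $\gamma\in\Gamma$ (resp. all $\gamma\in K$). A Hilbert basis of $\mathcal{P}(K)$ is a finite set of elements generating it as a $\mathbf{C}$-algebra. $\mathcal{P}_{\sigma^j}(\Gamma)$ is the $\mathcal{P}(\Gamma)$-module of polynomial functions $f:V\to\mathbf{C}$ with $f(\rho(\gamma)x)=\sigma^j(\gamma)f(x)$ for all $\gamma\in\Gamma$, $x\in V$. The operators $R_j:\mathcal{P}(K)\to\mathcal{P}(K)$ are $$R_j(f)(x)=\frac1m\sum_{k=0}^{m-1}\overline{\sigma(\delta)^{jk}}\,f(\rho(\delta^k) x).$$ $\vec{\mathcal{P}}(K)$ is the set of polynomial mappings $g:V\to V$ with $g(\rho(\kappa)x)=\eta(\kappa)g(x)$ for all $\kappa\in K$, $x\in V$ (a module over $\mathcal{P}(K)$, hence over $\mathcal{P}(\Gamma)$). $\vec{\mathcal{P}}_{\sigma^j}(\Gamma)$ is the $\mathcal{P}(\Gamma)$-module of polynomial mappings $g:V\to V$ with $g(\rho(\gamma)x)=\sigma^j(\gamma)\,\eta(\gamma)g(x)$ for all $\gamma\in\Gamma$, $x\in V$ (for $j=0$: the $\Gamma$-equivariant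 mappings). For $0\le j\le m-1$ the $\sigma^j$-relative Reynolds operator $\vec{R}_j:\vec{\mathcal{P}}(K)\to\vec{\mathcal{P}}(K)$ is $$\vec{R}_j(g)(x)=\frac1m\sum_{k=0}^{m-1}\overline{\sigma(\delta)^{jk}}\,\eta(\delta^{k})^{-1} g(\rho(\delta^k)x).$$ The bar denotes complex conjugation. *)

theory Defs
  imports
    "HOL-Analysis.Analysis"
    "HOL-Algebra.Coset"
    "HOL-Number_Theory.Cong"
begin

section \<open>Compact Lie groups\<close>

text \<open>
  Manifolds are modelled on the topological space \<^term>\<open>Euclidean_space n\<close> (sequences of reals
  vanishing from index \<open>n\<close> on) rather than on a type of class \<open>euclidean_space\<close>, since the latter
  would exclude dimension 0 and hence finite groups. Smoothness is the existence and continuity of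
  all iterated partial derivatives; the definitions are meant for sets \<open>U\<close> that are open in
  \<^term>\<open>Euclidean_space n\<close>, on which they do not depend on values outside \<open>U\<close>.
\<close>

definition partial_deriv :: "nat \<Rightarrow> ((nat \<Rightarrow> real) \<Rightarrow> real) \<Rightarrow> (nat \<Rightarrow> real) \<Rightarrow> real" where
  "partial_deriv i f x = deriv (\<lambda>t. f (x(i := t))) (x i)"

primrec Ck_on :: "nat \<Rightarrow> nat \<Rightarrow> (nat \<Rightarrow> real) set \<Rightarrow> ((nat \<Rightarrow> real) \<Rightarrow> real) \<Rightarrow> bool" where
  "Ck_on 0 n U f \<longleftrightarrow> continuous_map (subtopology (Euclidean_space n) U) euclideanreal f"
| "Ck_on (Suc k) n U f \<longleftrightarrow>
     continuous_map (subtopology (Euclidean_space n) U) euclideanreal f \<and>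
     (\<forall>i<n. (\<forall>x\<in>U. (\<lambda>t. f (x(i := t))) field_differentiable (at (x i))) \<and>
            Ck_on k n U (partial_deriv i f))"

definition smooth_map_on ::
  "nat \<Rightarrow> nat \<Rightarrow> (nat \<Rightarrow> real) set \<Rightarrow> ((nat \<Rightarrow> real) \<Rightarrow> nat \<Rightarrow> real) \<Rightarrow> bool" where
  "smooth_map_on n n' U f \<longleftrightarrow> (\<forall>i<n'. \<forall>k. Ck_on k n U (\<lambda>x. f x i))"

text \<open>A chart is a pair of its open domain and its coordinate map.\<close>

type_synonym 'g chart = "'g set \<times> ('g \<Rightarrow> nat \<Rightarrow> real)"

definition is_chart :: "'g topology \<Rightarrow> nat \<Rightarrow> 'g chart \<Rightarrow> bool" where
  "is_chart T n = (\<lambda>(U, \<phi>).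
     openin T U \<and> openin (Euclidean_space n) (\<phi> ` U) \<and>
     homeomorphic_map (subtopology T U) (subtopology (Euclidean_space n) (\<phi> ` U)) \<phi>)"

definition smooth_manifold :: "'g topology \<Rightarrow> nat \<Rightarrow> 'g chart set \<Rightarrow> bool" where
  "smooth_manifold T n \<A> \<longleftrightarrow>
     Hausdorff_space T \<and> second_countable T \<and>
     (\<forall>c\<in>\<A>. is_chart T n c) \<and>
     (\<Union>(U, \<phi>)\<in>\<A>. U) = topspace T \<and>
     (\<forall>(U, \<phi>)\<in>\<A>. \<forall>(V, \<psi>)\<in>\<A>.
        smooth_map_on n n (\<psi> ` (U \<inter> V)) (\<lambda>y. \<phi> (inv_into V \<psi> y)))"

text \<open>Coordinates on \<open>G \<times> G\<close>: a point of \<open>\<real>\<^sup>2\<^sup>n\<close> is split into its first and last \<open>n\<close> entries.\<close>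

definition left_half :: "nat \<Rightarrow> (nat \<Rightarrow> real) \<Rightarrow> nat \<Rightarrow> real" where
  "left_half n z = (\<lambda>i. if i < n then z i else 0)"

definition right_half :: "nat \<Rightarrow> (nat \<Rightarrow> real) \<Rightarrow> nat \<Rightarrow> real" where
  "right_half n z = (\<lambda>i. if i < n then z (n + i) else 0)"

definition lie_group ::
  "('g, 'more) monoid_scheme \<Rightarrow> 'g topology \<Rightarrow> nat \<Rightarrow> 'g chart set \<Rightarrow> bool" where
  "lie_group G T n \<A> \<longleftrightarrow>
     group G \<and> topspace T = carrier G \<and> smooth_manifold T n \<A> \<and>
     continuous_map (prod_topology T T) T (\<lambda>(x, y). x \<otimes>\<^bsub>G\<^esub> y) \<and>
     continuous_map T T (\<lambda>x. inv\<^bsub>G\<^esub> x) \<and>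
     (\<forall>(U, \<phi>)\<in>\<A>. \<forall>(V, \<psi>)\<in>\<A>. \<forall>(W, \<theta>)\<in>\<A>.
        smooth_map_on (2 * n) n
          {z \<in> topspace (Euclidean_space (2 * n)).
             left_half n z \<in> \<phi> ` U \<and> right_half n z \<in> \<psi> ` V \<and>
             inv_into U \<phi> (left_half n z) \<otimes>\<^bsub>G\<^esub> inv_into V \<psi> (right_half n z) \<in> W}
          (\<lambda>z. \<theta> (inv_into U \<phi> (left_half n z) \<otimes>\<^bsub>G\<^esub> inv_into V \<psi> (right_half n z)))) \<and>
     (\<forall>(U, \<phi>)\<in>\<A>. \<forall>(V, \<psi>)\<in>\<A>.
        smooth_map_on n n {y \<in> \<phi> ` U. inv\<^bsub>G\<^esub> (inv_into U \<phi> y) \<in> V}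
          (\<lambda>y. \<psi> (inv\<^bsub>G\<^esub> (inv_into U \<phi> y))))"

definition compact_lie_group ::
  "('g, 'more) monoid_scheme \<Rightarrow> 'g topology \<Rightarrow> nat \<Rightarrow> 'g chart set \<Rightarrow> bool" where
  "compact_lie_group G T n \<A> \<longleftrightarrow> lie_group G T n \<A> \<and> compact_space T"

section \<open>Roots of unity and representations\<close>

definition roots_of_unity :: "nat \<Rightarrow> complex monoid" where
  "roots_of_unity m = \<lparr>carrier = {z. z ^ m = 1}, monoid.mult = (*), one = 1\<rparr>"

definition primitive_root_of_unity :: "nat \<Rightarrow> complex \<Rightarrow> bool" where
  "primitive_root_of_unity m z \<longleftrightarrow> z ^ m = 1 \<and> (\<forall>k. 0 < k \<and> k < m \<longrightarrow> z ^ k \<noteq> 1)"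

text \<open>
  A complex vector space is given by its scalar multiplication \<open>scl\<close> on a type, so
  \<open>Vector_Spaces.linear scl (*)\<close> singles out the linear functionals.
\<close>

definition GL :: "(complex \<Rightarrow> 'v::ab_group_add \<Rightarrow> 'v) \<Rightarrow> ('v \<Rightarrow> 'v) monoid" where
  "GL scl = \<lparr>carrier = {f. Vector_Spaces.linear scl scl f \<and> bij f},
               monoid.mult = (\<circ>), one = id\<rparr>"

text \<open>
  Representations of topological groups are continuous. On a finite-dimensional space this means
  that all matrix coefficients are continuous.
\<close>

definition representation ::
  "('g, 'more) monoid_scheme \<Rightarrow> 'g topology \<Rightarrow> (complex \<Rightarrow> 'v::ab_group_add \<Rightarrow> 'v) \<Rightarrow>
   ('g \<Rightarrow> 'v \<Rightarrow> 'v) \<Rightarrow> bool" where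
  "representation G T scl \<rho> \<longleftrightarrow>
     \<rho> \<in> hom G (GL scl) \<and>
     (\<forall>\<phi> v. Vector_Spaces.linear scl (*) \<phi> \<longrightarrow> continuous_map T euclidean (\<lambda>\<gamma>. \<phi> (\<rho> \<gamma> v)))"

section \<open>Polynomial functions and mappings\<close>

inductive polynomial_fun ::
  "(complex \<Rightarrow> 'v::ab_group_add \<Rightarrow> 'v) \<Rightarrow> ('v \<Rightarrow> complex) \<Rightarrow> bool"
  for scl :: "complex \<Rightarrow> 'v::ab_group_add \<Rightarrow> 'v" where
  linear: "Vector_Spaces.linear scl (*) f \<Longrightarrow> polynomial_fun scl f"
| const: "polynomial_fun scl (\<lambda>x. c)"
| add: "polynomial_fun scl f \<Longrightarrow> polynomial_fun scl g \<Longrightarrow> polynomial_fun scl (\<lambda>x. f x + g x)"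
| mult: "polynomial_fun scl f \<Longrightarrow> polynomial_fun scl g \<Longrightarrow> polynomial_fun scl (\<lambda>x. f x * g x)"

definition polynomial_mapping ::
  "(complex \<Rightarrow> 'v::ab_group_add \<Rightarrow> 'v) \<Rightarrow> ('v \<Rightarrow> 'v) \<Rightarrow> bool" where
  "polynomial_mapping scl g \<longleftrightarrow>
     (\<forall>\<phi>. Vector_Spaces.linear scl (*) \<phi> \<longrightarrow> polynomial_fun scl (\<phi> \<circ> g))"

text \<open>
  In the next two definitions \<open>S\<close> is the set of group elements under which invariance or
  equivariance is required (the whole group, or the kernel of \<open>\<sigma>\<close>).
\<close>

definition invariants ::
  "(complex \<Rightarrow> 'v::ab_group_add \<Rightarrow> 'v) \<Rightarrow> ('g \<Rightarrow> 'v \<Rightarrow> 'v) \<Rightarrow> 'g set \<Rightarrow> ('v \<Rightarrow> complex) set" where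
  "invariants scl \<rho> S =
     {f. polynomial_fun scl f \<and> (\<forall>\<gamma>\<in>S. \<forall>x. f (\<rho> \<gamma> x) = f x)}"

definition equivariants ::
  "(complex \<Rightarrow> 'v::ab_group_add \<Rightarrow> 'v) \<Rightarrow> ('g \<Rightarrow> 'v \<Rightarrow> 'v) \<Rightarrow> ('g \<Rightarrow> 'v \<Rightarrow> 'v) \<Rightarrow> 'g set \<Rightarrow>
   ('v \<Rightarrow> 'v) set" where
  "equivariants scl \<rho> \<eta> S =
     {g. polynomial_mapping scl g \<and> (\<forall>\<gamma>\<in>S. \<forall>x. g (\<rho> \<gamma> x) = \<eta> \<gamma> (g x))}"

definition relative_invariants ::
  "('g, 'more) monoid_scheme \<Rightarrow> (complex \<Rightarrow> 'v::ab_group_add \<Rightarrow> 'v) \<Rightarrow> ('g \<Rightarrow> 'v \<Rightarrow> 'v) \<Rightarrow>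
   ('g \<Rightarrow> complex) \<Rightarrow> nat \<Rightarrow> ('v \<Rightarrow> complex) set" where
  "relative_invariants G scl \<rho> \<sigma> j =
     {f. polynomial_fun scl f \<and> (\<forall>\<gamma>\<in>carrier G. \<forall>x. f (\<rho> \<gamma> x) = \<sigma> \<gamma> ^ j * f x)}"

definition relative_equivariants ::
  "('g, 'more) monoid_scheme \<Rightarrow> (complex \<Rightarrow> 'v::ab_group_add \<Rightarrow> 'v) \<Rightarrow> ('g \<Rightarrow> 'v \<Rightarrow> 'v) \<Rightarrow>
   ('g \<Rightarrow> 'v \<Rightarrow> 'v) \<Rightarrow> ('g \<Rightarrow> complex) \<Rightarrow> nat \<Rightarrow> ('v \<Rightarrow> 'v) set" where
  "relative_equivariants G scl \<rho> \<eta> \<sigma> j =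
     {g. polynomial_mapping scl g \<and>
         (\<forall>\<gamma>\<in>carrier G. \<forall>x. g (\<rho> \<gamma> x) = scl (\<sigma> \<gamma> ^ j) (\<eta> \<gamma> (g x)))}"

section \<open>Reynolds operators\<close>

definition reynolds_fun ::
  "('g, 'more) monoid_scheme \<Rightarrow> ('g \<Rightarrow> 'v \<Rightarrow> 'v) \<Rightarrow> ('g \<Rightarrow> complex) \<Rightarrow> 'g \<Rightarrow> nat \<Rightarrow> nat \<Rightarrow>
   ('v \<Rightarrow> complex) \<Rightarrow> 'v \<Rightarrow> complex" where
  "reynolds_fun G \<rho> \<sigma> \<delta> m j f x =
     1 / of_nat m * (\<Sum>k<m. cnj (\<sigma> \<delta> ^ (j * k)) * f (\<rho> (\<delta> [^]\<^bsub>G\<^esub> k) x))"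

definition reynolds_map ::
  "('g, 'more) monoid_scheme \<Rightarrow> (complex \<Rightarrow> 'v::ab_group_add \<Rightarrow> 'v) \<Rightarrow> ('g \<Rightarrow> 'v \<Rightarrow> 'v) \<Rightarrow>
   ('g \<Rightarrow> 'v \<Rightarrow> 'v) \<Rightarrow> ('g \<Rightarrow> complex) \<Rightarrow> 'g \<Rightarrow> nat \<Rightarrow> nat \<Rightarrow> ('v \<Rightarrow> 'v) \<Rightarrow> 'v \<Rightarrow> 'v" where
  "reynolds_map G scl \<rho> \<eta> \<sigma> \<delta> m j g x =
     scl (1 / of_nat m)
       (\<Sum>k<m. scl (cnj (\<sigma> \<delta> ^ (j * k)))
                 ((inv\<^bsub>GL scl\<^esub> (\<eta> (\<delta> [^]\<^bsub>G\<^esub> k))) (g (\<rho> (\<delta> [^]\<^bsub>G\<^esub> k) x))))"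

section \<open>Generating sets\<close>

inductive_set generated_algebra :: "('v \<Rightarrow> complex) set \<Rightarrow> ('v \<Rightarrow> complex) set"
  for U :: "('v \<Rightarrow> complex) set" where
  gen: "u \<in> U \<Longrightarrow> u \<in> generated_algebra U"
| const: "(\<lambda>x. c) \<in> generated_algebra U"
| add: "f \<in> generated_algebra U \<Longrightarrow> g \<in> generated_algebra U \<Longrightarrow>
        (\<lambda>x. f x + g x) \<in> generated_algebra U"
| mult: "f \<in> generated_algebra U \<Longrightarrow> g \<in> generated_algebra U \<Longrightarrow>
         (\<lambda>x. f x * g x) \<in> generated_algebra U"

definition hilbert_basis :: "('v \<Rightarrow> complex) set \<Rightarrow> ('v \<Rightarrow> complex) set \<Rightarrow> bool" where
  "hilbert_basis U P \<longleftrightarrow> finite U \<and> U \<subseteq> P \<and> generated_algebra U = P"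

text \<open>
  Finite linear combinations of elements of \<open>S\<close>, functions on \<open>V\<close>, with coefficients in a ring \<open>A\<close>
  of functions on \<open>V\<close> acting pointwise through \<open>smul\<close>: this is multiplication in \<open>\<complex>\<close> for modules
  of functions, and scalar multiplication in \<open>V\<close> for modules of mappings.
\<close>

definition fun_span ::
  "(complex \<Rightarrow> 'w \<Rightarrow> 'w::comm_monoid_add) \<Rightarrow> ('v \<Rightarrow> complex) set \<Rightarrow> ('v \<Rightarrow> 'w) set \<Rightarrow>
   ('v \<Rightarrow> 'w) set" where
  "fun_span smul A S =
     {\<lambda>x. \<Sum>s\<in>F. smul (a s x) (s x) | F a. finite F \<and> F \<subseteq> S \<and> (\<forall>s\<in>F. a s \<in> A)}"

definition generates_module ::
  "(complex \<Rightarrow> 'w \<Rightarrow> 'w::comm_monoid_add) \<Rightarrow> ('v \<Rightarrow> complex) set \<Rightarrow> ('v \<Rightarrow> 'w) set \<Rightarrow>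
   ('v \<Rightarrow> 'w) set \<Rightarrow> bool" where
  "generates_module smul A S M \<longleftrightarrow> S \<subseteq> M \<and> fun_span smul A S = M"

end

theory Submission
  imports Defs
begin

text \<open>
  Averaging over the powers of \<open>\<delta>\<close> only sees the cosets of \<open>K\<close>, which \<open>\<sigma>\<close> identifies with the
  \<open>m\<close>-th roots of unity, so each Reynolds operator is a discrete Fourier projection: it lands in the
  \<open>\<sigma>\<^sup>j\<close>-relative part, fixes that part, is linear over the \<open>\<Gamma>\<close>-invariants, and the \<open>m\<close> projections
  sum to the identity. Hence \<open>\<P>(K)\<close> is the sum of the \<open>\<P>\<^bsub>\<sigma>\<^sup>l\<^esub>(\<Gamma>)\<close> and is generated by the \<open>v\<^sub>i\<close>, and
  applying the \<open>j\<close>-th operator to an expansion of a relative equivariant over the \<open>v\<^sub>i H\<^sub>k\<close>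
  returns it as a \<open>\<P>(\<Gamma>)\<close>-combination of the images of the \<open>v\<^sub>i H\<^sub>k\<close>.
\<close>

section \<open>Spans over rings of functions\<close>

lemma fun_span_base:
  assumes "s \<in> S" "a \<in> A"
  shows "(\<lambda>x. smul (a x) (s x)) \<in> fun_span smul A S"
  unfolding fun_span_def
  by (rule CollectI, rule exI[of _ "{s}"], rule exI[of _ "\<lambda>_. a"]) (use assms in auto)

lemma fun_span_mono: "S \<subseteq> S' \<Longrightarrow> fun_span smul A S \<subseteq> fun_span smul A S'"
  unfolding fun_span_def by blast

text \<open>Two combinations may have different, overlapping supports. Both are extended by zero
  coefficients to the union, where the coefficients add; hence the closure conditions on
  \<open>A\<close>.\<close>

lemma fun_span_add:
  assumes "vector_space smul" and zero: "(\<lambda>x. 0) \<in> A"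
    and add: "\<And>a b. a \<in> A \<Longrightarrow> b \<in> A \<Longrightarrow> (\<lambda>x. a x + b x) \<in> A"
    and f: "f \<in> fun_span smul A S" and g: "g \<in> fun_span smul A S"
  shows "(\<lambda>x. f x + g x) \<in> fun_span smul A S"
proof -
  interpret vector_space smul by fact
  obtain F a where F: "finite F" "F \<subseteq> S" "\<forall>s\<in>F. a s \<in> A"
    and f_eq: "f = (\<lambda>x. \<Sum>s\<in>F. smul (a s x) (s x))"
    using f unfolding fun_span_def by blast
  obtain F' b where F': "finite F'" "F' \<subseteq> S" "\<forall>s\<in>F'. b s \<in> A"
    and g_eq: "g = (\<lambda>x. \<Sum>s\<in>F'. smul (b s x) (s x))"
    using g unfolding fun_span_def by blast
  define c where "c = (\<lambda>s x. (if s \<in> F then a s x else 0) + (if s \<in> F' then b s x else 0))"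
  have "(\<Sum>s\<in>F. smul (a s x) (s x)) = (\<Sum>s\<in>F \<union> F'. smul (if s \<in> F then a s x else 0) (s x))" for x
    by (rule sum.mono_neutral_cong_left) (use F F' in auto)
  moreover have
    "(\<Sum>s\<in>F'. smul (b s x) (s x)) = (\<Sum>s\<in>F \<union> F'. smul (if s \<in> F' then b s x else 0) (s x))" for x
    by (rule sum.mono_neutral_cong_left) (use F F' in auto)
  ultimately have "(\<lambda>x. f x + g x) = (\<lambda>x. \<Sum>s\<in>F \<union> F'. smul (c s x) (s x))"
    unfolding f_eq g_eq c_def by (simp add: sum.distrib scale_left_distrib)
  moreover have "c s \<in> A" if "s \<in> F \<union> F'" for s
    unfolding c_def using that F F' zero by (intro add) (cases "s \<in> F"; cases "s \<in> F'"; simp)+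
  ultimately show ?thesis
    unfolding fun_span_def using F F' by blast
qed

text \<open>Lets a sum over any finite index set count as an element of the span even if several
  indices give the same generator, although \<open>fun_span\<close> has one coefficient per
  generator.\<close>

lemma fun_span_sum:
  assumes "vector_space smul" "(\<lambda>x. 0) \<in> A"
    and "\<And>a b. a \<in> A \<Longrightarrow> b \<in> A \<Longrightarrow> (\<lambda>x. a x + b x) \<in> A"
    and "finite I" "\<And>i. i \<in> I \<Longrightarrow> f i \<in> fun_span smul A S"
  shows "(\<lambda>x. \<Sum>i\<in>I. f i x) \<in> fun_span smul A S"
  using assms(4,5)
proof (induction I rule: finite_induct)
  case empty
  show ?case
    unfolding fun_span_def
    by (rule CollectI, rule exI[of _ "{}"], rule exI[of _ "\<lambda>_ _. 0"]) simp
next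
  case (insert i I)
  have "(\<lambda>x. f i x + (\<Sum>i\<in>I. f i x)) \<in> fun_span smul A S"
    by (rule fun_span_add[OF assms(1-3)]) (use insert in auto)
  then show ?case using insert.hyps by simp
qed

text \<open>Minimality of the span, by induction on the support. It supplies the easy inclusion in
  \<open>generates_module\<close>.\<close>

lemma fun_span_subset:
  assumes "S \<subseteq> M" "(\<lambda>x. 0) \<in> M"
    and add: "\<And>f g. f \<in> M \<Longrightarrow> g \<in> M \<Longrightarrow> (\<lambda>x. f x + g x) \<in> M"
    and scale: "\<And>a f. a \<in> A \<Longrightarrow> f \<in> M \<Longrightarrow> (\<lambda>x. smul (a x) (f x)) \<in> M"
  shows "fun_span smul A S \<subseteq> M"
proof -
  have "(\<lambda>x. \<Sum>s\<in>F. smul (a s x) (s x)) \<in> M"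
    if "finite F" "F \<subseteq> S" "\<forall>s\<in>F. a s \<in> A" for F a
    using that
  proof (induction F rule: finite_induct)
    case empty
    then show ?case using assms(2) by simp
  next
    case (insert t F)
    then show ?case
      using add[OF scale[of "a t" t], of "\<lambda>x. \<Sum>s\<in>F. smul (a s x) (s x)"] assms(1) by auto
  qed
  then show ?thesis
    unfolding fun_span_def by blast
qed

section \<open>Polynomial functions and mappings\<close>

lemma polynomial_fun_scale: "polynomial_fun scl f \<Longrightarrow> polynomial_fun scl (\<lambda>x. c * f x)"
  by (rule polynomial_fun.mult[OF polynomial_fun.const])

lemma polynomial_fun_sum:
  assumes "finite I" "\<And>i. i \<in> I \<Longrightarrow> polynomial_fun scl (f i)"
  shows "polynomial_fun scl (\<lambda>x. \<Sum>i\<in>I. f i x)"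
  using assms by (induction I rule: finite_induct) (auto intro: polynomial_fun.intros)

text \<open>Only the base case has content: a functional after a linear map is a functional.
  Substituting \<open>\<rho> \<gamma> x\<close> therefore preserves polynomials.\<close>

lemma polynomial_fun_compose_linear:
  assumes "polynomial_fun scl f" "Vector_Spaces.linear scl scl L"
  shows "polynomial_fun scl (\<lambda>x. f (L x))"
  using assms
proof (induction rule: polynomial_fun.induct)
  case (linear f)
  then show ?case
    using Vector_Spaces.linear_compose[of scl scl L "(*)" f]
    by (auto simp: o_def intro: polynomial_fun.linear)
qed (auto intro: polynomial_fun.intros)

lemma polynomial_mapping_zero: "polynomial_mapping scl (\<lambda>x. 0)"
  unfolding polynomial_mapping_def by (auto simp: o_def intro: polynomial_fun.const)

lemma polynomial_mapping_add:
  assumes "polynomial_mapping scl f" "polynomial_mapping scl g"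
  shows "polynomial_mapping scl (\<lambda>x. f x + g x)"
  using assms unfolding polynomial_mapping_def
  by (auto simp: o_def Vector_Spaces.linear_iff intro: polynomial_fun.add)

text \<open>A functional pulls the scalar out, which leaves the product of the polynomials
  \<open>a\<close> and \<open>\<phi> \<circ> g\<close>.\<close>

lemma polynomial_mapping_scale:
  assumes "polynomial_fun scl a" "polynomial_mapping scl g"
  shows "polynomial_mapping scl (\<lambda>x. scl (a x) (g x))"
  unfolding polynomial_mapping_def
proof (intro allI impI)
  fix \<phi> assume \<phi>: "Vector_Spaces.linear scl (*) \<phi>"
  then have "polynomial_fun scl (\<lambda>x. a x * (\<phi> \<circ> g) x)"
    using assms unfolding polynomial_mapping_def by (intro polynomial_fun.mult) blast+
  then show "polynomial_fun scl (\<phi> \<circ> (\<lambda>x. scl (a x) (g x)))"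
    using \<phi> by (simp add: o_def Vector_Spaces.linear_iff)
qed

lemma polynomial_mapping_sum:
  assumes "finite I" "\<And>i. i \<in> I \<Longrightarrow> polynomial_mapping scl (f i)"
  shows "polynomial_mapping scl (\<lambda>x. \<Sum>i\<in>I. f i x)"
  using assms
  by (induction I rule: finite_induct) (auto intro: polynomial_mapping_zero polynomial_mapping_add)

text \<open>The outer map is absorbed into the functional, since \<open>\<phi> \<circ> L'\<close> is
  again linear; the inner one is a linear substitution.\<close>

lemma polynomial_mapping_compose_linear:
  assumes g: "polynomial_mapping scl g"
    and L: "Vector_Spaces.linear scl scl L" "Vector_Spaces.linear scl scl L'"
  shows "polynomial_mapping scl (\<lambda>x. L' (g (L x)))"
  unfolding polynomial_mapping_def
proof (intro allI impI)
  fix \<phi> assume "Vector_Spaces.linear scl (*) \<phi>"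
  then have "Vector_Spaces.linear scl (*) (\<phi> \<circ> L')"
    using L(2) by (rule Vector_Spaces.linear_compose[rotated])
  then have "polynomial_fun scl ((\<phi> \<circ> L') \<circ> g)"
    using g unfolding polynomial_mapping_def by blast
  from polynomial_fun_compose_linear[OF this L(1)]
  show "polynomial_fun scl (\<phi> \<circ> (\<lambda>x. L' (g (L x))))"
    by (simp add: o_def)
qed

section \<open>Roots of unity\<close>

text \<open>The first \<open>m\<close> powers of \<open>w\<close> are distinct solutions of
  \<open>z ^ m = 1\<close>, which has exactly \<open>m\<close> solutions, so by counting they are
  all of them.\<close>

lemma primitive_root_of_unity_powers:
  assumes m: "m > 0" and w: "primitive_root_of_unity m w" and z: "z ^ m = 1"
  obtains i where "z = w ^ i"
proof -
  have wm: "w ^ m = 1" and prim: "\<And>k. 0 < k \<Longrightarrow> k < m \<Longrightarrow> w ^ k \<noteq> 1"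
    using w unfolding primitive_root_of_unity_def by auto
  have w0: "w \<noteq> 0" using wm m by (auto simp: power_0_left)
  have "w ^ a \<noteq> w ^ b" if "a < b" "b < m" for a b
  proof
    assume "w ^ a = w ^ b"
    also have "\<dots> = w ^ a * w ^ (b - a)"
      using that power_add[of w a "b - a"] by simp
    \<comment> \<open>Cancelling \<open>w ^ a\<close> leaves \<open>w ^ (b - a) = 1\<close> with an
      exponent strictly between 0 and \<open>m\<close>.\<close>
    finally show False using prim[of "b - a"] that w0 by simp
  qed
  then have "inj_on (\<lambda>i. w ^ i) {..<m}"
    by (intro linorder_inj_onI) auto
  then have "card ((\<lambda>i. w ^ i) ` {..<m}) = card {z::complex. z ^ m = 1}"
    using m by (simp add: card_image card_roots_unity_eq)
  moreover have "(\<lambda>i. w ^ i) ` {..<m} \<subseteq> {z. z ^ m = 1}"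
    using wm by auto (metis mult.commute power_mult power_one)
  ultimately have "(\<lambda>i. w ^ i) ` {..<m} = {z. z ^ m = 1}"
    using m by (intro card_subset_eq finite_roots_unity) auto
  then show thesis using z that by auto
qed

text \<open>Roots of unity lie on the unit circle, where conjugation is inversion. This is how the
  conjugates in the Reynolds operators cancel character values.\<close>

lemma root_of_unity_cnj_mult:
  assumes "m > 0" "(w::complex) ^ m = 1"
  shows "cnj w * w = 1"
proof -
  have "norm w ^ m = 1"
    using assms(2) by (simp flip: norm_power)
  then have "norm w = 1"
    using power_eq_imp_eq_base[of "norm w" m 1] assms(1) by simp
  then show ?thesis
    using complex_norm_square[of w] by (simp add: mult.commute)
qed

text \<open>Orthogonality of characters: for \<open>k \<noteq> 0\<close> the sum is the conjugate of
  a geometric sum of length \<open>m\<close> whose ratio \<open>w ^ k\<close> differs from 1 but has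
  \<open>m\<close>-th power 1.\<close>

lemma sum_cnj_primitive_root_powers:
  assumes m: "m > 0" and w: "primitive_root_of_unity m w" and k: "k < m"
  shows "(\<Sum>j<m. cnj (w ^ (j * k))) = (if k = 0 then of_nat m else 0)"
proof (cases "k = 0")
  case False
  then have "w ^ k \<noteq> 1"
    using w k unfolding primitive_root_of_unity_def by auto
  moreover have "(w ^ k) ^ m = 1"
    using w unfolding primitive_root_of_unity_def by (metis mult.commute power_mult power_one)
  ultimately have "(\<Sum>j<m. (w ^ k) ^ j) = 0"
    using geometric_sum[of "w ^ k" m] by simp
  then have "(\<Sum>j<m. w ^ (j * k)) = 0"
    by (simp add: mult.commute flip: power_mult)
  then show ?thesis
    using False by (metis cnj_sum complex_cnj_zero)
qed simp

text \<open>Each unit shift drops the term \<open>h i\<close> at the front and gains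
  \<open>h (i + m)\<close> at the end, which is equal by periodicity.\<close>

lemma sum_shift_periodic:
  fixes h :: "nat \<Rightarrow> 'a::comm_monoid_add"
  assumes "\<And>k. h (k + m) = h k"
  shows "(\<Sum>k<m. h (k + i)) = (\<Sum>k<m. h k)"
proof (induction i)
  case (Suc i)
  have "(\<Sum>k<m. h (k + Suc i)) = (\<Sum>k<m. h (k + i))"
  proof (cases m)
    case (Suc m')
    have "(\<Sum>k<m. h (k + Suc i)) = (\<Sum>k<m'. h (Suc k + i)) + h (0 + i)"
      using assms[of i] Suc by (simp add: add.commute)
    also have "\<dots> = (\<Sum>k<m. h (k + i))"
      unfolding Suc sum.lessThan_Suc_shift by (simp add: add.commute)
    finally show ?thesis .
  qed simp
  then show ?case using Suc.IH by simp
qed simp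

section \<open>Twisted averages over the powers of an element\<close>

lemma monoid_GL:
  assumes "vector_space scl"
  shows "monoid (GL scl)"
  using assms
  by (intro monoidI)
    (auto simp: GL_def o_assoc bij_comp vector_space.linear_id intro: Vector_Spaces.linear_compose)

lemma hom_GL_linear: "\<theta> \<in> hom G (GL smul) \<Longrightarrow> \<gamma> \<in> carrier G \<Longrightarrow> Vector_Spaces.linear smul smul (\<theta> \<gamma>)"
  by (auto simp: hom_def GL_def)

lemma hom_GL_mult:
  "\<theta> \<in> hom G (GL smul) \<Longrightarrow> \<gamma> \<in> carrier G \<Longrightarrow> \<gamma>' \<in> carrier G \<Longrightarrow>
   \<theta> (\<gamma> \<otimes>\<^bsub>G\<^esub> \<gamma>') x = \<theta> \<gamma> (\<theta> \<gamma>' x)"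
  by (auto simp: hom_def GL_def)

context group
begin

text \<open>\<open>hom\<close> demands multiplicativity only, so this needs an argument: the image
  of \<open>\<one>\<close> is idempotent, and an injective idempotent map is the identity.\<close>

lemma hom_GL_one:
  assumes "\<theta> \<in> hom G (GL smul)"
  shows "\<theta> \<one> x = x"
proof -
  have "\<theta> \<one> (\<theta> \<one> x) = \<theta> \<one> x"
    using hom_GL_mult[OF assms, of \<one> \<one> x] by simp
  moreover have "inj (\<theta> \<one>)"
    using assms by (auto simp: hom_def GL_def bij_def)
  ultimately show ?thesis by (auto dest: injD)
qed

lemma hom_GL_inv:
  assumes "\<theta> \<in> hom G (GL smul)" "\<gamma> \<in> carrier G"
  shows "\<theta> (inv \<gamma>) (\<theta> \<gamma> x) = x" "\<theta> \<gamma> (\<theta> (inv \<gamma>) x) = x"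
  using assms hom_GL_mult[OF assms(1), of "inv \<gamma>" \<gamma> x] hom_GL_mult[OF assms(1), of \<gamma> "inv \<gamma>" x]
  by (simp_all add: hom_GL_one)

text \<open>Trades the inverse in \<open>GL scl\<close>, which occurs in
  \<open>reynolds_map\<close>, for the value at a group inverse, so that products can be computed
  inside \<open>G\<close>.\<close>

lemma GL_inv_hom:
  assumes "vector_space scl" "\<theta> \<in> hom G (GL scl)" "\<gamma> \<in> carrier G"
  shows "inv\<^bsub>GL scl\<^esub> (\<theta> \<gamma>) = \<theta> (inv \<gamma>)"
proof (rule monoid.inv_unique'[OF monoid_GL[OF assms(1)], symmetric])
  show "\<theta> \<gamma> \<otimes>\<^bsub>GL scl\<^esub> \<theta> (inv \<gamma>) = \<one>\<^bsub>GL scl\<^esub>"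
    "\<theta> (inv \<gamma>) \<otimes>\<^bsub>GL scl\<^esub> \<theta> \<gamma> = \<one>\<^bsub>GL scl\<^esub>"
    using hom_GL_inv[OF assms(2,3)] by (auto simp: GL_def)
  show "\<theta> \<gamma> \<in> carrier (GL scl)" "\<theta> (inv \<gamma>) \<in> carrier (GL scl)"
    using assms(2,3) by (auto simp: hom_def)
qed

end

section \<open>Characters with values in the roots of unity\<close>

text \<open>Since \<open>\<sigma> \<delta>\<close> is primitive, the powers of
  \<open>\<delta>\<close> represent all cosets of the kernel; the averages below run over these
  representatives.\<close>

locale cyclic_character = group G for G :: "('g, 'more) monoid_scheme" (structure) +
  fixes \<sigma> :: "'g \<Rightarrow> complex" and \<delta> :: 'g and m :: nat
  assumes m_pos: "m > 0"
    and \<sigma>_hom: "\<sigma> \<in> hom G (roots_of_unity m)"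
    and \<delta>_closed: "\<delta> \<in> carrier G"
    and \<sigma>_\<delta>: "primitive_root_of_unity m (\<sigma> \<delta>)"
begin

lemma \<sigma>_mult: "\<gamma> \<in> carrier G \<Longrightarrow> \<gamma>' \<in> carrier G \<Longrightarrow> \<sigma> (\<gamma> \<otimes> \<gamma>') = \<sigma> \<gamma> * \<sigma> \<gamma>'"
  using \<sigma>_hom by (auto simp: hom_def roots_of_unity_def)

lemma \<sigma>_root: "\<gamma> \<in> carrier G \<Longrightarrow> \<sigma> \<gamma> ^ m = 1"
  using \<sigma>_hom by (auto simp: hom_def roots_of_unity_def)

lemma \<sigma>_nonzero: "\<gamma> \<in> carrier G \<Longrightarrow> \<sigma> \<gamma> \<noteq> 0"
  using \<sigma>_root m_pos by (metis power_0_left zero_neq_one less_irrefl)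

lemma \<sigma>_one: "\<sigma> \<one> = 1"
  using \<sigma>_mult[of \<one> \<one>] \<sigma>_nonzero[of \<one>] by simp

lemma \<sigma>_inv: "\<gamma> \<in> carrier G \<Longrightarrow> \<sigma> \<gamma> * \<sigma> (inv \<gamma>) = 1"
  using \<sigma>_mult[of \<gamma> "inv \<gamma>"] \<sigma>_one by simp

lemma \<sigma>_pow: "\<gamma> \<in> carrier G \<Longrightarrow> \<sigma> (\<gamma> [^] (k::nat)) = \<sigma> \<gamma> ^ k"
  by (induction k) (auto simp: \<sigma>_one \<sigma>_mult mult.commute)

lemma \<delta>_pow_closed [simp]: "\<delta> [^] (k::nat) \<in> carrier G"
  using \<delta>_closed by simp

lemma cnj_\<sigma>_pow: "cnj (\<sigma> \<delta> ^ k) * \<sigma> \<delta> ^ k = 1"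
  using root_of_unity_cnj_mult[OF m_pos \<sigma>_root[OF \<delta>_closed]]
  by (simp flip: power_mult_distrib)

abbreviation "K \<equiv> kernel G (roots_of_unity m) \<sigma>"

lemma mem_K: "\<gamma> \<in> K \<longleftrightarrow> \<gamma> \<in> carrier G \<and> \<sigma> \<gamma> = 1"
  by (auto simp: kernel_def roots_of_unity_def)

text \<open>
  With \<open>smul = (*)\<close> and the trivial representation on \<open>\<complex>\<close> this is the operator on functions,
  so both Reynolds operators are instances.
\<close>

definition twisted_average ::
  "(complex \<Rightarrow> 'w::ab_group_add \<Rightarrow> 'w) \<Rightarrow> ('g \<Rightarrow> 'v::ab_group_add \<Rightarrow> 'v) \<Rightarrow> ('g \<Rightarrow> 'w \<Rightarrow> 'w) \<Rightarrow>
   nat \<Rightarrow> ('v \<Rightarrow> 'w) \<Rightarrow> 'v \<Rightarrow> 'w" where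
  "twisted_average smul \<rho> \<theta> j g x = smul (1 / of_nat m)
     (\<Sum>k<m. smul (cnj (\<sigma> \<delta> ^ (j * k))) (\<theta> (inv (\<delta> [^] k)) (g (\<rho> (\<delta> [^] k) x))))"

lemma reynolds_fun_eq: "reynolds_fun G \<rho> \<sigma> \<delta> m j f = twisted_average (*) \<rho> (\<lambda>_. id) j f"
  by (rule ext) (simp add: reynolds_fun_def twisted_average_def)

lemma reynolds_map_eq:
  assumes "vector_space scl" "\<eta> \<in> hom G (GL scl)"
  shows "reynolds_map G scl \<rho> \<eta> \<sigma> \<delta> m j g = twisted_average scl \<rho> \<eta> j g"
  by (rule ext) (simp add: reynolds_map_def twisted_average_def GL_inv_hom[OF assms])

lemma trivial_hom_GL: "vector_space smul \<Longrightarrow> (\<lambda>_. id) \<in> hom G (GL smul)"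
  by (auto simp: hom_def GL_def vector_space.linear_id)

section \<open>Fourier projections attached to the character\<close>

text \<open>Elements with equal character values differ by a factor in \<open>K\<close>.
  Equivariance moves this factor through \<open>g\<close>, where \<open>\<theta>\<close> of its
  inverse cancels it, so the expression depends only on the coset.\<close>

lemma twist_cong:
  assumes \<rho>: "\<rho> \<in> hom G (GL scl)" and \<theta>: "\<theta> \<in> hom G (GL smul)"
    and g: "\<And>\<kappa> x. \<kappa> \<in> K \<Longrightarrow> g (\<rho> \<kappa> x) = \<theta> \<kappa> (g x)"
    and \<gamma>: "\<gamma> \<in> carrier G" "\<gamma>' \<in> carrier G" "\<sigma> \<gamma> = \<sigma> \<gamma>'"
  shows "\<theta> (inv \<gamma>) (g (\<rho> \<gamma> x)) = \<theta> (inv \<gamma>') (g (\<rho> \<gamma>' x))"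
proof -
  \<comment> \<open>Standing to the left of \<open>\<gamma>\<close>, this factor acts last under
    \<open>\<rho>\<close> and so meets \<open>g\<close> directly.\<close>
  define \<kappa> where "\<kappa> = \<gamma>' \<otimes> inv \<gamma>"
  have \<kappa>: "\<kappa> \<in> K"
    using \<gamma> \<sigma>_inv[of \<gamma>] by (simp add: mem_K \<kappa>_def \<sigma>_mult)
  then have \<kappa>c: "\<kappa> \<in> carrier G" by (simp add: mem_K)
  have \<gamma>': "\<gamma>' = \<kappa> \<otimes> \<gamma>"
    using \<gamma> by (simp add: \<kappa>_def m_assoc)
  have "\<theta> (inv \<gamma>') (g (\<rho> \<gamma>' x)) = \<theta> (inv \<gamma> \<otimes> inv \<kappa>) (g (\<rho> \<kappa> (\<rho> \<gamma> x)))"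
    using \<gamma> \<kappa>c by (simp add: \<gamma>' inv_mult_group hom_GL_mult[OF \<rho>])
  also have "\<dots> = \<theta> (inv \<gamma>) (g (\<rho> \<gamma> x))"
    using \<gamma> \<kappa> \<kappa>c by (simp add: hom_GL_mult[OF \<theta>] g hom_GL_inv[OF \<theta>])
  finally show ?thesis by simp
qed

text \<open>With \<open>\<sigma> \<gamma> = \<sigma> \<delta> ^ i\<close>, passing from
  \<open>x\<close> to \<open>\<rho> \<gamma> x\<close> moves term \<open>k\<close> to the coset of
  \<open>\<delta> [^] (k + i)\<close> and splits off \<open>\<theta> \<gamma>\<close>. Cyclic
  reindexing undoes the shift, and the coefficients leave
  \<open>\<sigma> \<gamma> ^ j\<close>.\<close>

lemma twisted_average_equivariant:
  assumes "vector_space smul" and \<rho>: "\<rho> \<in> hom G (GL scl)" and \<theta>: "\<theta> \<in> hom G (GL smul)"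
    and g: "\<And>\<kappa> x. \<kappa> \<in> K \<Longrightarrow> g (\<rho> \<kappa> x) = \<theta> \<kappa> (g x)"
    and \<gamma>: "\<gamma> \<in> carrier G"
  shows "twisted_average smul \<rho> \<theta> j g (\<rho> \<gamma> x) =
         smul (\<sigma> \<gamma> ^ j) (\<theta> \<gamma> (twisted_average smul \<rho> \<theta> j g x))"
proof -
  interpret vector_space smul by fact
  define h where "h = (\<lambda>k. \<theta> (inv (\<delta> [^] k)) (g (\<rho> (\<delta> [^] (k::nat)) x)))"
  define t where "t = (\<lambda>k. smul (cnj (\<sigma> \<delta> ^ (j * k))) (h k))"
  interpret L: Vector_Spaces.linear smul smul "\<theta> \<gamma>"
    using \<theta> \<gamma> by (rule hom_GL_linear)
  have twist: "\<theta> (inv \<alpha>) (g (\<rho> \<alpha> x)) = \<theta> (inv \<beta>) (g (\<rho> \<beta> x))"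
    if "\<alpha> \<in> carrier G" "\<beta> \<in> carrier G" "\<sigma> \<alpha> = \<sigma> \<beta>" for \<alpha> \<beta>
    using twist_cong[where \<rho> = \<rho> and \<theta> = \<theta> and g = g, OF \<rho> \<theta> _ that] g by simp
  \<comment> \<open>\<open>\<delta> [^] m\<close> lies in \<open>K\<close> but may differ from
    \<open>\<one>\<close>, so periodicity comes from \<open>twist\<close> and not from the order of
    \<open>\<delta>\<close>.\<close>
  have h_periodic: "h (k + m) = h k" for k
  proof -
    have "\<sigma> (\<delta> [^] (k + m)) = \<sigma> (\<delta> [^] k)"
      using \<delta>_closed by (simp add: \<sigma>_pow power_add \<sigma>_root)
    then show ?thesis
      unfolding h_def by (intro twist \<delta>_pow_closed)
  qed
  have t_periodic: "t (k + m) = t k" for k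
  proof -
    have "\<sigma> \<delta> ^ (j * (k + m)) = \<sigma> \<delta> ^ (j * k) * (\<sigma> \<delta> ^ m) ^ j"
      by (simp add: algebra_simps power_add flip: power_mult)
    then show ?thesis
      using h_periodic \<sigma>_root[OF \<delta>_closed] by (simp add: t_def del: complex_cnj_power)
  qed
  obtain i where i: "\<sigma> \<gamma> = \<sigma> \<delta> ^ i"
    using primitive_root_of_unity_powers[OF m_pos \<sigma>_\<delta> \<sigma>_root[OF \<gamma>]] by blast
  \<comment> \<open>\<open>?\<mu>\<close> need not be a power of \<open>\<delta>\<close>, but it has
    the character value of \<open>\<delta> [^] (k + i)\<close>, so \<open>twist\<close> may replace
    it.\<close>
  have shift: "\<theta> (inv (\<delta> [^] k)) (g (\<rho> (\<delta> [^] k) (\<rho> \<gamma> x))) = \<theta> \<gamma> (h (k + i))" for k :: nat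
  proof -
    let ?\<mu> = "\<delta> [^] k \<otimes> \<gamma>"
    have "\<gamma> \<otimes> inv ?\<mu> = inv (\<delta> [^] k)"
      using \<gamma> by (simp add: inv_mult_group flip: m_assoc)
    then have "\<theta> (inv (\<delta> [^] k)) (g (\<rho> (\<delta> [^] k) (\<rho> \<gamma> x))) = \<theta> \<gamma> (\<theta> (inv ?\<mu>) (g (\<rho> ?\<mu> x)))"
      using \<gamma> hom_GL_mult[OF \<theta>, of \<gamma> "inv ?\<mu>"] by (simp add: hom_GL_mult[OF \<rho>])
    also have "\<theta> (inv ?\<mu>) (g (\<rho> ?\<mu> x)) = h (k + i)"
    proof -
      have "\<sigma> ?\<mu> = \<sigma> (\<delta> [^] (k + i))"
        using \<delta>_closed \<gamma> by (simp add: \<sigma>_pow \<sigma>_mult i power_add)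
      then show ?thesis
        unfolding h_def by (intro twist \<delta>_pow_closed m_closed \<gamma>)
    qed
    finally show ?thesis .
  qed
  \<comment> \<open>Shifting \<open>k\<close> by \<open>i\<close> costs the conjugate of
    \<open>\<sigma> \<delta> ^ (j * i)\<close>, which \<open>\<sigma> \<gamma> ^ j\<close>
    compensates on the unit circle.\<close>
  have coeff: "cnj (\<sigma> \<delta> ^ (j * k)) = \<sigma> \<gamma> ^ j * cnj (\<sigma> \<delta> ^ (j * (k + i)))" for k
  proof -
    have "\<sigma> \<gamma> ^ j = \<sigma> \<delta> ^ (j * i)"
      by (simp add: i mult.commute flip: power_mult)
    then have "\<sigma> \<gamma> ^ j * cnj (\<sigma> \<delta> ^ (j * (k + i))) =
        (cnj (\<sigma> \<delta> ^ (j * i)) * \<sigma> \<delta> ^ (j * i)) * cnj (\<sigma> \<delta> ^ (j * k))"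
      by (simp add: algebra_simps power_add)
    then show ?thesis
      unfolding cnj_\<sigma>_pow by simp
  qed
  have "smul (cnj (\<sigma> \<delta> ^ (j * k))) (\<theta> \<gamma> (h (k + i))) = smul (\<sigma> \<gamma> ^ j) (\<theta> \<gamma> (t (k + i)))" for k
    by (subst coeff) (simp only: t_def L.scale scale_scale)
  then have "twisted_average smul \<rho> \<theta> j g (\<rho> \<gamma> x) =
        smul (1 / of_nat m) (\<Sum>k<m. smul (\<sigma> \<gamma> ^ j) (\<theta> \<gamma> (t (k + i))))"
    unfolding twisted_average_def shift by simp
  also have "\<dots> = smul (1 / of_nat m) (smul (\<sigma> \<gamma> ^ j) (\<theta> \<gamma> (\<Sum>k<m. t (k + i))))"
    by (simp add: scale_sum_right L.sum)
  also have "(\<Sum>k<m. t (k + i)) = (\<Sum>k<m. t k)"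
    using t_periodic by (rule sum_shift_periodic[where h = t])
  finally show ?thesis
    by (simp add: twisted_average_def t_def h_def L.scale mult.commute)
qed

text \<open>After exchanging the sums, orthogonality kills every \<open>k \<noteq> 0\<close> and
  leaves \<open>m\<close> times the term of the identity element, which is
  \<open>g x\<close>.\<close>

lemma sum_twisted_average:
  assumes "vector_space smul" and \<rho>: "\<rho> \<in> hom G (GL scl)" and \<theta>: "\<theta> \<in> hom G (GL smul)"
  shows "(\<Sum>j<m. twisted_average smul \<rho> \<theta> j g x) = g x"
proof -
  interpret vector_space smul by fact
  define h where "h = (\<lambda>k. \<theta> (inv (\<delta> [^] k)) (g (\<rho> (\<delta> [^] (k::nat)) x)))"
  have "(\<Sum>j<m. twisted_average smul \<rho> \<theta> j g x) =
        smul (1 / of_nat m) (\<Sum>j<m. \<Sum>k<m. smul (cnj (\<sigma> \<delta> ^ (j * k))) (h k))"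
    by (simp add: twisted_average_def h_def scale_sum_right)
  also have "(\<Sum>j<m. \<Sum>k<m. smul (cnj (\<sigma> \<delta> ^ (j * k))) (h k)) =
        (\<Sum>k<m. smul (\<Sum>j<m. cnj (\<sigma> \<delta> ^ (j * k))) (h k))"
    unfolding scale_sum_left by (rule sum.swap)
  also have "\<dots> = (\<Sum>k<m. if k = 0 then smul (of_nat m) (h 0) else 0)"
    by (rule sum.cong) (auto simp: sum_cnj_primitive_root_powers[OF m_pos \<sigma>_\<delta>] simp del: complex_cnj_power)
  also have "\<dots> = smul (of_nat m) (h 0)"
    using m_pos by simp
  also have "h 0 = g x"
    by (simp add: h_def hom_GL_one[OF \<rho>] hom_GL_one[OF \<theta>])
  finally show ?thesis
    using m_pos by simp
qed

text \<open>For a relative equivariant every summand already equals \<open>g x\<close>: the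
  character value produced by \<open>g\<close> cancels against its conjugate.\<close>

lemma twisted_average_fixed:
  assumes "vector_space smul" and \<theta>: "\<theta> \<in> hom G (GL smul)"
    and g: "\<And>\<gamma> x. \<gamma> \<in> carrier G \<Longrightarrow> g (\<rho> \<gamma> x) = smul (\<sigma> \<gamma> ^ j) (\<theta> \<gamma> (g x))"
  shows "twisted_average smul \<rho> \<theta> j g x = g x"
proof -
  interpret vector_space smul by fact
  have "smul (cnj (\<sigma> \<delta> ^ (j * k))) (\<theta> (inv (\<delta> [^] k)) (g (\<rho> (\<delta> [^] k) x))) = g x" for k :: nat
  proof -
    interpret L: Vector_Spaces.linear smul smul "\<theta> (inv (\<delta> [^] k))"
      using \<theta> by (rule hom_GL_linear) simp
    have "\<sigma> (\<delta> [^] k) ^ j = \<sigma> \<delta> ^ (j * k)"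
      using \<delta>_closed by (simp add: \<sigma>_pow mult.commute flip: power_mult)
    then have "\<theta> (inv (\<delta> [^] k)) (g (\<rho> (\<delta> [^] k) x)) = smul (\<sigma> \<delta> ^ (j * k)) (g x)"
      by (simp add: g L.scale hom_GL_inv[OF \<theta>])
    then show ?thesis
      using cnj_\<sigma>_pow[of "j * k"] by (simp del: complex_cnj_power)
  qed
  then have "twisted_average smul \<rho> \<theta> j g x = smul (1 / of_nat m) (\<Sum>k<m. g x)"
    unfolding twisted_average_def by simp
  also have "(\<Sum>k<m. g x) = smul (of_nat m) (g x)"
    using scale_sum_left[of "\<lambda>_. 1" "{..<m}" "g x"] by simp
  finally show ?thesis
    using m_pos by simp
qed

text \<open>Invariant coefficients do not notice the substitution of
  \<open>\<rho> (\<delta> [^] k) x\<close>, so they pass through the linear maps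
  \<open>\<theta>\<close> as constants.\<close>

lemma twisted_average_linear_combination:
  assumes "vector_space smul" and \<theta>: "\<theta> \<in> hom G (GL smul)"
    and a: "\<And>i \<gamma> x. i \<in> I \<Longrightarrow> \<gamma> \<in> carrier G \<Longrightarrow> a i (\<rho> \<gamma> x) = a i x"
  shows "twisted_average smul \<rho> \<theta> j (\<lambda>x. \<Sum>i\<in>I. smul (a i x) (g i x)) x =
         (\<Sum>i\<in>I. smul (a i x) (twisted_average smul \<rho> \<theta> j (g i) x))"
proof -
  interpret vector_space smul by fact
  have "\<theta> (inv (\<delta> [^] k)) (\<Sum>i\<in>I. smul (a i (\<rho> (\<delta> [^] k) x)) (g i (\<rho> (\<delta> [^] k) x))) =
        (\<Sum>i\<in>I. smul (a i x) (\<theta> (inv (\<delta> [^] k)) (g i (\<rho> (\<delta> [^] k) x))))" for k :: nat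
  proof -
    interpret L: Vector_Spaces.linear smul smul "\<theta> (inv (\<delta> [^] k))"
      using \<theta> by (rule hom_GL_linear) simp
    show ?thesis
      unfolding L.sum by (rule sum.cong) (auto simp: L.scale a)
  qed
  then show ?thesis
    unfolding twisted_average_def
    by (simp add: scale_sum_right mult_ac sum.swap[of _ I])
qed

section \<open>Reynolds operators on polynomials\<close>

lemma polynomial_fun_reynolds:
  assumes "\<rho> \<in> hom G (GL scl)" "polynomial_fun scl f"
  shows "polynomial_fun scl (reynolds_fun G \<rho> \<sigma> \<delta> m j f)"
  unfolding reynolds_fun_def
  by (intro polynomial_fun_scale polynomial_fun_sum polynomial_fun_compose_linear[OF assms(2)]
      hom_GL_linear[OF assms(1)]) auto

lemma polynomial_mapping_twisted_average:
  assumes "\<rho> \<in> hom G (GL scl)" "\<eta> \<in> hom G (GL scl)" "polynomial_mapping scl g"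
  shows "polynomial_mapping scl (twisted_average scl \<rho> \<eta> j g)"
  unfolding twisted_average_def
  by (intro polynomial_mapping_scale polynomial_fun.const polynomial_mapping_sum
      polynomial_mapping_compose_linear[OF assms(3)] hom_GL_linear[OF assms(1)]
      hom_GL_linear[OF assms(2)]) auto

text \<open>Equivariance of the twisted average, with the complex numbers as target space and the
  trivial action on them.\<close>

lemma reynolds_fun_relative_invariant:
  assumes \<rho>: "\<rho> \<in> hom G (GL scl)" and f: "f \<in> invariants scl \<rho> K"
  shows "reynolds_fun G \<rho> \<sigma> \<delta> m j f \<in> relative_invariants G scl \<rho> \<sigma> j"
proof -
  have "reynolds_fun G \<rho> \<sigma> \<delta> m j f (\<rho> \<gamma> x) = \<sigma> \<gamma> ^ j * reynolds_fun G \<rho> \<sigma> \<delta> m j f x"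
    if "\<gamma> \<in> carrier G" for \<gamma> x
    unfolding reynolds_fun_eq
    using twisted_average_equivariant[OF vector_space_over_itself.vector_space_axioms \<rho>
        trivial_hom_GL[OF vector_space_over_itself.vector_space_axioms], of f \<gamma> j x] that f
    by (simp add: invariants_def)
  then show ?thesis
    using polynomial_fun_reynolds[OF \<rho>] f by (simp add: relative_invariants_def invariants_def)
qed

lemma reynolds_map_relative_equivariant:
  assumes "vector_space scl" and \<rho>: "\<rho> \<in> hom G (GL scl)" and \<eta>: "\<eta> \<in> hom G (GL scl)"
    and g: "g \<in> equivariants scl \<rho> \<eta> K"
  shows "reynolds_map G scl \<rho> \<eta> \<sigma> \<delta> m j g \<in> relative_equivariants G scl \<rho> \<eta> \<sigma> j"
  using polynomial_mapping_twisted_average[OF \<rho> \<eta>, of g j] g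
    twisted_average_equivariant[OF assms(1) \<rho> \<eta>, of g _ j]
  by (simp add: reynolds_map_eq[OF assms(1) \<eta>] relative_equivariants_def equivariants_def)

end

section \<open>Generators of relative equivariants\<close>

lemma invariants_zero: "(\<lambda>x. 0) \<in> invariants scl \<rho> S"
  by (simp add: invariants_def polynomial_fun.const)

lemma invariants_add:
  "f \<in> invariants scl \<rho> S \<Longrightarrow> g \<in> invariants scl \<rho> S \<Longrightarrow> (\<lambda>x. f x + g x) \<in> invariants scl \<rho> S"
  by (simp add: invariants_def polynomial_fun.add)

lemma invariants_mult:
  "f \<in> invariants scl \<rho> S \<Longrightarrow> g \<in> invariants scl \<rho> S \<Longrightarrow> (\<lambda>x. f x * g x) \<in> invariants scl \<rho> S"
  by (simp add: invariants_def polynomial_fun.mult)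

lemma invariants_antimono: "S \<subseteq> S' \<Longrightarrow> invariants scl \<rho> S' \<subseteq> invariants scl \<rho> S"
  by (auto simp: invariants_def)

context cyclic_character
begin

text \<open>On \<open>K\<close> the character is 1, so the twist disappears.\<close>

lemma relative_invariants_subset: "relative_invariants G scl \<rho> \<sigma> j \<subseteq> invariants scl \<rho> K"
  by (auto simp: relative_invariants_def invariants_def mem_K)

lemma relative_equivariants_subset:
  "vector_space scl \<Longrightarrow> relative_equivariants G scl \<rho> \<eta> \<sigma> j \<subseteq> equivariants scl \<rho> \<eta> K"
  by (auto simp: relative_equivariants_def equivariants_def mem_K
      vector_space.vector_space_assms(4))

text \<open>Each \<open>f\<close> is the sum of its projections, and the \<open>j\<close>-th
  projection is a relative invariant, hence a combination of elements of \<open>B j\<close>.\<close>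

lemma invariants_generated:
  assumes \<rho>: "\<rho> \<in> hom G (GL scl)"
    and B: "\<And>l. l < m \<Longrightarrow> generates_module (*) (invariants scl \<rho> (carrier G)) (B l)
             (relative_invariants G scl \<rho> \<sigma> l)"
  shows "generates_module (*) (invariants scl \<rho> (carrier G)) (\<Union>l<m. B l) (invariants scl \<rho> K)"
    (is "generates_module _ ?A ?S ?M")
proof -
  have sub: "?S \<subseteq> ?M"
    using B relative_invariants_subset unfolding generates_module_def by blast
  have A_M: "?A \<subseteq> ?M"
    by (intro invariants_antimono) (auto simp: mem_K)
  have "fun_span (*) ?A ?S \<subseteq> ?M"
    using sub A_M by (intro fun_span_subset) (auto intro: invariants_zero invariants_add invariants_mult)
  moreover have "f \<in> fun_span (*) ?A ?S" if f: "f \<in> ?M" for f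
  proof -
    have "reynolds_fun G \<rho> \<sigma> \<delta> m j f \<in> fun_span (*) ?A ?S" if "j < m" for j
    proof -
      have "reynolds_fun G \<rho> \<sigma> \<delta> m j f \<in> fun_span (*) ?A (B j)"
        using B[OF that] reynolds_fun_relative_invariant[OF \<rho> f] unfolding generates_module_def by simp
      also have "\<dots> \<subseteq> fun_span (*) ?A ?S"
        using that by (intro fun_span_mono) auto
      finally show ?thesis .
    qed
    then have "(\<lambda>x. \<Sum>j<m. reynolds_fun G \<rho> \<sigma> \<delta> m j f x) \<in> fun_span (*) ?A ?S"
      by (intro fun_span_sum vector_space_over_itself.vector_space_axioms)
        (auto intro: invariants_zero invariants_add)
    then show ?thesis
      using sum_twisted_average[OF vector_space_over_itself.vector_space_axioms \<rho>
          trivial_hom_GL[OF vector_space_over_itself.vector_space_axioms], of f]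
      by (simp add: reynolds_fun_eq)
  qed
  ultimately show ?thesis
    using sub unfolding generates_module_def by blast
qed

text \<open>Expand over \<open>W\<close>, then expand the coefficients over \<open>V\<close>, so
  that only coefficients invariant under the whole group remain. The projection fixes relative
  equivariants and commutes with such coefficients.\<close>

lemma relative_equivariants_generated:
  assumes vs: "vector_space scl" and \<rho>: "\<rho> \<in> hom G (GL scl)" and \<eta>: "\<eta> \<in> hom G (GL scl)"
    and V: "generates_module (*) (invariants scl \<rho> (carrier G)) V (invariants scl \<rho> K)"
    and W: "generates_module scl (invariants scl \<rho> K) W (equivariants scl \<rho> \<eta> K)"
  shows "generates_module scl (invariants scl \<rho> (carrier G))
           {reynolds_map G scl \<rho> \<eta> \<sigma> \<delta> m j (\<lambda>x. scl (v x) (h x)) | v h. v \<in> V \<and> h \<in> W}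
           (relative_equivariants G scl \<rho> \<eta> \<sigma> j)"
    (is "generates_module _ ?A ?S ?M")
proof -
  interpret vector_space scl by fact
  have prod: "(\<lambda>x. scl (v x) (h x)) \<in> equivariants scl \<rho> \<eta> K" if "v \<in> V" "h \<in> W" for v h
  proof -
    have v: "v \<in> invariants scl \<rho> K" and h: "h \<in> equivariants scl \<rho> \<eta> K"
      using that V W unfolding generates_module_def by auto
    have "scl (v (\<rho> \<kappa> x)) (h (\<rho> \<kappa> x)) = \<eta> \<kappa> (scl (v x) (h x))" if "\<kappa> \<in> K" for \<kappa> x
    proof -
      interpret L: Vector_Spaces.linear scl scl "\<eta> \<kappa>"
        using \<eta> by (rule hom_GL_linear) (use that in \<open>simp add: mem_K\<close>)
      show ?thesis
        using v h that by (simp add: invariants_def equivariants_def L.scale)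
    qed
    then show ?thesis
      using v h polynomial_mapping_scale[of scl v h] by (simp add: invariants_def equivariants_def)
  qed
  have sub: "?S \<subseteq> ?M"
    using reynolds_map_relative_equivariant[OF vs \<rho> \<eta> prod] by blast
  have "fun_span scl ?A ?S \<subseteq> ?M"
  proof (rule fun_span_subset[OF sub])
    have lin: "Vector_Spaces.linear scl scl (\<eta> \<gamma>)" if "\<gamma> \<in> carrier G" for \<gamma>
      using hom_GL_linear[OF \<eta> that] .
    show "(\<lambda>x. 0) \<in> ?M"
      using module_hom.zero[OF Vector_Spaces.linear.axioms(3)[OF lin]]
      by (simp add: relative_equivariants_def polynomial_mapping_zero)
    show "(\<lambda>x. f x + g x) \<in> ?M" if "f \<in> ?M" "g \<in> ?M" for f g
      using that lin
      by (simp add: relative_equivariants_def polynomial_mapping_add Vector_Spaces.linear_iff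
          scale_right_distrib)
    show "(\<lambda>x. scl (a x) (f x)) \<in> ?M" if "a \<in> ?A" "f \<in> ?M" for a f
      using that lin
      by (simp add: relative_equivariants_def invariants_def polynomial_mapping_scale
          Vector_Spaces.linear_iff mult.commute)
  qed
  moreover have "g \<in> fun_span scl ?A ?S" if g: "g \<in> ?M" for g
  proof -
    have "g \<in> fun_span scl (invariants scl \<rho> K) W"
      using g W relative_equivariants_subset[OF vs] unfolding generates_module_def by blast
    then obtain F a where F: "finite F" "F \<subseteq> W" "\<forall>h\<in>F. a h \<in> invariants scl \<rho> K"
      and g_eq: "g = (\<lambda>x. \<Sum>h\<in>F. scl (a h x) (h x))"
      unfolding fun_span_def by blast
    \<comment> \<open>The support of the expansion over \<open>V\<close> varies with
      \<open>h\<close>, so it is chosen together with its coefficients for each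
      \<open>h\<close>.\<close>
    have "\<forall>h\<in>F. \<exists>F' b. finite F' \<and> F' \<subseteq> V \<and> (\<forall>v\<in>F'. b v \<in> ?A) \<and>
            a h = (\<lambda>x. \<Sum>v\<in>F'. b v x * v x)"
      using F(3) V unfolding generates_module_def fun_span_def by blast
    then obtain F' b where F': "\<And>h. h \<in> F \<Longrightarrow> finite (F' h)" "\<And>h. h \<in> F \<Longrightarrow> F' h \<subseteq> V"
      and b: "\<And>h v. h \<in> F \<Longrightarrow> v \<in> F' h \<Longrightarrow> b h v \<in> ?A"
      and a_eq: "\<And>h. h \<in> F \<Longrightarrow> a h = (\<lambda>x. \<Sum>v\<in>F' h. b h v x * v x)"
      unfolding bchoice_iff by blast
    \<comment> \<open>The double sum becomes a single one over dependent pairs, with the mapping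
      \<open>h\<close> first and the function \<open>v\<close> second.\<close>
    define I where "I = Sigma F F'"
    have "finite I"
      unfolding I_def using F(1) F'(1) by blast
    have "g x = (\<Sum>(h, v)\<in>I. scl (b h v x) (scl (v x) (h x)))" for x
    proof -
      have "g x = (\<Sum>h\<in>F. \<Sum>v\<in>F' h. scl (b h v x) (scl (v x) (h x)))"
        unfolding g_eq by (rule sum.cong) (simp_all add: a_eq scale_sum_left)
      also have "\<dots> = (\<Sum>(h, v)\<in>I. scl (b h v x) (scl (v x) (h x)))"
        unfolding I_def using F(1) F'(1) by (intro sum.Sigma) auto
      finally show ?thesis .
    qed
    then have g_eq':
      "g = (\<lambda>x. \<Sum>i\<in>I. scl (b (fst i) (snd i) x) (scl (snd i x) (fst i x)))"
      by (auto simp: case_prod_beta)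
    \<comment> \<open>Applying the projection to \<open>g\<close> changes nothing, so it may be
      applied to the expansion instead.\<close>
    have "g x = twisted_average scl \<rho> \<eta> j g x" for x
      using g by (subst twisted_average_fixed[OF vs \<eta>]) (auto simp: relative_equivariants_def)
    also have "twisted_average scl \<rho> \<eta> j g x =
        (\<Sum>i\<in>I. scl (b (fst i) (snd i) x)
           (twisted_average scl \<rho> \<eta> j (\<lambda>x. scl (snd i x) (fst i x)) x))" for x
      unfolding g_eq'
      by (rule twisted_average_linear_combination[OF vs \<eta>])
        (use b in \<open>auto simp: I_def invariants_def\<close>)
    finally have "g = (\<lambda>x. \<Sum>i\<in>I. scl (b (fst i) (snd i) x)
        (reynolds_map G scl \<rho> \<eta> \<sigma> \<delta> m j (\<lambda>x. scl (snd i x) (fst i x)) x))"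
      by (auto simp: reynolds_map_eq[OF vs \<eta>])
    \<comment> \<open>Different pairs may yield the same generator, so membership is shown term by
      term and the terms are added inside the span.\<close>
    also have "\<dots> \<in> fun_span scl ?A ?S"
    proof (intro fun_span_sum fun_span_base vs \<open>finite I\<close> invariants_zero invariants_add)
      fix i assume "i \<in> I"
      then show "b (fst i) (snd i) \<in> ?A"
        using b by (auto simp: I_def)
      show "reynolds_map G scl \<rho> \<eta> \<sigma> \<delta> m j (\<lambda>x. scl (snd i x) (fst i x)) \<in> ?S"
        using \<open>i \<in> I\<close> F(2) F'(2) unfolding I_def by fastforce
    qed
    finally show ?thesis .
  qed
  ultimately show ?thesis
    using sub unfolding generates_module_def by blast
qed

end

theorem theorem4p5:
  fixes G :: "('g, 'more) monoid_scheme"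
    and T :: "'g topology" and n :: nat and \<A> :: "'g chart set"
    and m :: nat and \<sigma> :: "'g \<Rightarrow> complex" and \<delta> :: 'g
    and scl :: "complex \<Rightarrow> 'v::ab_group_add \<Rightarrow> 'v" and E :: "'v set"
    and \<rho> \<eta> :: "'g \<Rightarrow> 'v \<Rightarrow> 'v"
    and s p q :: nat
    and u v :: "nat \<Rightarrow> 'v \<Rightarrow> complex"
    and B :: "nat \<Rightarrow> ('v \<Rightarrow> complex) set"
    and H :: "nat \<Rightarrow> 'v \<Rightarrow> 'v"
  defines "K \<equiv> kernel G (roots_of_unity m) \<sigma>"
  assumes "m \<ge> 2"
    and "compact_lie_group G T n \<A>"
    and "\<sigma> \<in> epi G (roots_of_unity m)"
    and "\<delta> \<in> carrier G" and "primitive_root_of_unity m (\<sigma> \<delta>)"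
    and "finite_dimensional_vector_space scl E"
    and "representation G T scl \<rho>" and "representation G T scl \<eta>"
    and "hilbert_basis (u ` {1..s}) (invariants scl \<rho> K)"
    and "B 0 = {\<lambda>x. 1}"
    and "\<And>l. l \<in> {1..m - 1} \<Longrightarrow> finite (B l)"
    and "\<And>l. l \<in> {1..m - 1} \<Longrightarrow>
           generates_module (*) (invariants scl \<rho> (carrier G)) (B l)
             (relative_invariants G scl \<rho> \<sigma> l)"
    and "\<And>l b. l \<in> {1..m - 1} \<Longrightarrow> b \<in> B l \<Longrightarrow>
           \<exists>\<alpha> :: nat \<Rightarrow> nat \<Rightarrow> nat.
             b = (\<lambda>x. \<Prod>r=1..m - 1. \<Prod>i=1..s. reynolds_fun G \<rho> \<sigma> \<delta> m r (u i) x ^ \<alpha> r i) \<and>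
             [(\<Sum>r=1..m - 1. r * (\<Sum>i=1..s. \<alpha> r i)) = l] (mod m)"
    and "(\<Union>l\<in>{0..m - 1}. B l) = v ` {0..p}" and "v 0 = (\<lambda>x. 1)"
    and "generates_module scl (invariants scl \<rho> K) (H ` {0..q}) (equivariants scl \<rho> \<eta> K)"
  shows "generates_module (*) (invariants scl \<rho> (carrier G)) (v ` {0..p}) (invariants scl \<rho> K) \<and>
         (\<forall>j\<in>{0..m - 1}.
            generates_module scl (invariants scl \<rho> (carrier G))
              {reynolds_map G scl \<rho> \<eta> \<sigma> \<delta> m j (\<lambda>x. scl (v i x) (H k x)) | i k.
                 i \<in> {0..p} \<and> k \<in> {0..q}}
              (relative_equivariants G scl \<rho> \<eta> \<sigma> j))"
proof -
  have "group G"
    using assms(3) by (simp add: compact_lie_group_def lie_group_def)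
  then interpret group G .
  interpret cyclic_character G \<sigma> \<delta> m
    by unfold_locales (use assms(2,4-6) in \<open>auto simp: epi_def\<close>)
  have vs: "vector_space scl"
    using assms(7) by (simp add: finite_dimensional_vector_space_def)
  have \<rho>: "\<rho> \<in> hom G (GL scl)" and \<eta>: "\<eta> \<in> hom G (GL scl)"
    using assms(8,9) by (auto simp: representation_def)
  have inv0: "relative_invariants G scl \<rho> \<sigma> 0 = invariants scl \<rho> (carrier G)"
    by (simp add: relative_invariants_def invariants_def)
  have one: "(\<lambda>x. 1) \<in> invariants scl \<rho> (carrier G)"
    by (simp add: invariants_def polynomial_fun.const)
  \<comment> \<open>For \<open>l = 0\<close> the relative invariants are the invariants, and 1 alone
    generates them as a module over themselves. The other \<open>l\<close> are covered by
    hypothesis.\<close>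
  have "generates_module (*) (invariants scl \<rho> (carrier G)) (B 0) (relative_invariants G scl \<rho> \<sigma> 0)"
    unfolding inv0 generates_module_def assms(11)
  proof (intro conjI equalityI fun_span_subset subsetI)
    show "f \<in> invariants scl \<rho> (carrier G)" if "f \<in> {\<lambda>x. 1}" for f
      using one that by simp
    show "f \<in> fun_span (*) (invariants scl \<rho> (carrier G)) {\<lambda>x. 1}"
      if "f \<in> invariants scl \<rho> (carrier G)" for f
      using fun_span_base[of "\<lambda>x. 1" "{\<lambda>x. 1}" f _ "(*)"] that by simp
  qed (use one in \<open>auto intro: invariants_zero invariants_add invariants_mult\<close>)
  then have "generates_module (*) (invariants scl \<rho> (carrier G)) (B l)
      (relative_invariants G scl \<rho> \<sigma> l)" if "l < m" for l
    using assms(13)[of l] that by (cases "l = 0") auto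
  note gen = invariants_generated[OF \<rho> this]
  \<comment> \<open>Reconciles the index range of the statement with that of
    \<open>invariants_generated\<close>; with truncated subtraction this relies on \<open>m\<close>
    being positive.\<close>
  moreover have "{0..m - 1} = {..<m}"
    using m_pos by auto
  ultimately have V:
    "generates_module (*) (invariants scl \<rho> (carrier G)) (v ` {0..p}) (invariants scl \<rho> K)"
    using assms(15) unfolding K_def by simp
  \<comment> \<open>The general result speaks of sets of functions and mappings, the theorem of
    indexed families; both give the same generators.\<close>
  moreover have "{reynolds_map G scl \<rho> \<eta> \<sigma> \<delta> m j (\<lambda>x. scl (f x) (h x)) | f h.
        f \<in> v ` {0..p} \<and> h \<in> H ` {0..q}} =
      {reynolds_map G scl \<rho> \<eta> \<sigma> \<delta> m j (\<lambda>x. scl (v i x) (H k x)) | i k. i \<in> {0..p} \<and> k \<in> {0..q}}"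
    for j by blast
  ultimately show ?thesis
    using relative_equivariants_generated[OF vs \<rho> \<eta>, of "v ` {0..p}" "H ` {0..q}"] assms(17)
    unfolding K_def by auto
qed

end
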